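(* Let $k\ge 2$ and let $\mathcal{G}=\{G_1,G_2,\ldots,G_k\}$ be a family of connected graphs on a common vertex set $V$ with $|V|\ge 3$. Then $$\max_{1\le i\le k}\{\dim_f(G_i)\}\le \mathrm{Sd}_f(\mathcal{G})\le \min\left\{\sum_{i=1}^{k}\dim_f(G_i),\ \frac{|V|}{2}\right\}.$$ Moreover, the upper bound is achieved, i.e. $\mathrm{Sd}_f(\mathcal{G})=\min\left\{\sum_{i=1}^{k}\dim_f(G_i),\frac{|V|}{2}\right\}$, if the family $\mathcal{G}$ contains the complete graph $K_{|V|}$ on $V$ as a member.
   Context: Graphs are finite, simple and undirected. $d_G(x,y)$ is the least number of edges on a path joining $x$ and $y$ in $G$ ($\infty$ if there is none). For distinct $x,y\in V(G)$, $R_G\{x,y\}=\{z\in V(G): d_G(x,z)\ne d_G(y,z)\}$. For a function $g$ on $V$ and $U\subseteq V$, $g(U)=\sum_{s\in U}g(s)$. A resolving function of $G$ is a function $g:V(G)\to[0,1]$ with $g(R_G\{x,y\})\ge 1$ for all distinct $x,y\in V(G)$; the fractional dimension $\dim_f(G)$ is the minimum of $g(V(G))$ over all resolving functions $g$ of $G$. For a family $\mathcal{G}$ of graphs on a common vertex set $V$, a simultaneous resolving function is a function $g:V\to[0,1]$ that is a resolving function of every member of $\mathcal{G}$, and the simultaneous fractional dimension $\mathrm{Sd}_f(\mathcal{G})$ is the minimum of $g(V)$ over all simultaneous resolving functions $g$ of $\mathcal{G}$. The edge sets of the members need not be disjoint. *)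

theory Defs
  imports Complex_Main "HOL-Library.Extended_Nat" "Graph_Theory.Graph_Theory"
begin

text \<open>
  A finite simple undirected graph is a \<open>pair_graph\<close>: a finite, loop-free, symmetric set of
  ordered pairs over the vertex set \<open>pverts G\<close>; the edge \<open>xy\<close> is the pair of arcs
  \<open>(x, y)\<close>, \<open>(y, x)\<close>. A path from \<open>x\<close> to \<open>y\<close> is an \<open>apath\<close> (an arc walk without
  repeated vertices), and its length as a list is its number of edges.
\<close>

text \<open>On \<open>enat\<close> the infimum of a nonempty set is its least element, and that of the empty set is
  \<open>\<infinity>\<close>.\<close>

definition graph_dist :: "'a pair_pre_digraph \<Rightarrow> 'a \<Rightarrow> 'a \<Rightarrow> enat" where
  "graph_dist G x y = (INF p \<in> {p. pre_digraph.apath (with_proj G) x p y}. enat (length p))"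

definition resolving_neighbourhood :: "'a pair_pre_digraph \<Rightarrow> 'a \<Rightarrow> 'a \<Rightarrow> 'a set" where
  "resolving_neighbourhood G x y = {z \<in> pverts G. graph_dist G x z \<noteq> graph_dist G y z}"

text \<open>Functions on the vertex set are total functions of which only the values on the vertex set
  matter.\<close>

definition resolving_function :: "'a pair_pre_digraph \<Rightarrow> ('a \<Rightarrow> real) \<Rightarrow> bool" where
  "resolving_function G g \<longleftrightarrow>
     (\<forall>v \<in> pverts G. 0 \<le> g v \<and> g v \<le> 1) \<and>
     (\<forall>x \<in> pverts G. \<forall>y \<in> pverts G. x \<noteq> y \<longrightarrow> 1 \<le> sum g (resolving_neighbourhood G x y))"

text \<open>\<open>LEAST\<close> on the reals denotes a genuine minimum and is specified only where that minimum is
  attained.\<close>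

definition dim_f :: "'a pair_pre_digraph \<Rightarrow> real" where
  "dim_f G = (LEAST r. \<exists>g. resolving_function G g \<and> r = sum g (pverts G))"

definition simultaneous_resolving_function ::
    "'a set \<Rightarrow> 'a pair_pre_digraph set \<Rightarrow> ('a \<Rightarrow> real) \<Rightarrow> bool" where
  "simultaneous_resolving_function V \<G> g \<longleftrightarrow>
     (\<forall>v \<in> V. 0 \<le> g v \<and> g v \<le> 1) \<and> (\<forall>G \<in> \<G>. resolving_function G g)"

definition Sd_f :: "'a set \<Rightarrow> 'a pair_pre_digraph set \<Rightarrow> real" where
  "Sd_f V \<G> = (LEAST r. \<exists>g. simultaneous_resolving_function V \<G> g \<and> r = sum g V)"

end

theory Submission
  imports Defs "HOL-Analysis.Function_Topology"
begin

text \<open>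
  A simultaneous resolving function is a resolving function of each member, which gives the lower
  bound. For the upper bound, two candidates are resolving for every member. The constant
  \<open>1/2\<close> is one, because \<open>x\<close> and \<open>y\<close> themselves always lie in \<open>R{x, y}\<close>
  (\<open>simultaneous_resolving_function_half\<close>). The other is the sum of optimal resolving functions
  of the members, truncated at \<open>1\<close>: truncation keeps it above each summand
  (\<open>simultaneous_resolving_function_truncated_sum\<close>). In the complete graph \<open>R{x, y}\<close>
  is exactly \<open>{x, y}\<close>, and averaging the constraints \<open>g x + g y \<ge> 1\<close> over all pairs forces
  weight \<open>|V|/2\<close> (\<open>resolving_function_complete_weight\<close>); with the upper bound
  \<open>|V|/2\<close> this gives the equality.

  All comparisons speak of minima, so these have to be attained: the admissible functions form a
  nonempty compact subset of a power of \<open>[0, 1]\<close> on which the weight is continuous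
  (\<open>minimum_weight_attained\<close>). Both dimensions fall under one argument, since \<open>dim_f G\<close>
  is \<open>Sd_f\<close> of the one-member family \<open>{G}\<close>.
\<close>

text \<open>A minimiser exists by compactness of \<open>[0, 1]\<^sup>V\<close>. Functions are total here, so the search is
  confined to those with values in \<open>[0, 1]\<close> everywhere, which form a compact set by Tychonoff's
  theorem; a competitor is brought into this set by resetting it to \<open>0\<close> off \<open>V\<close>.\<close>

lemma minimum_weight_attained:
  fixes h :: "'a \<Rightarrow> real" and V :: "'a set" and \<S> :: "'a set set"
  defines "admissible \<equiv> \<lambda>g :: 'a \<Rightarrow> real.
    (\<forall>v \<in> V. 0 \<le> g v \<and> g v \<le> 1) \<and> (\<forall>S \<in> \<S>. 1 \<le> sum g S)"
  assumes "\<And>S. S \<in> \<S> \<Longrightarrow> S \<subseteq> V" and "admissible h"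
  obtains g where "admissible g" "\<And>g'. admissible g' \<Longrightarrow> sum g V \<le> sum g' V"
proof -
  define C where "C = {g :: 'a \<Rightarrow> real. (\<forall>v. 0 \<le> g v \<and> g v \<le> 1) \<and> (\<forall>S \<in> \<S>. 1 \<le> sum g S)}"
  define reset where "reset g v = (if v \<in> V then g v else 0)" for g :: "'a \<Rightarrow> real" and v
  have reset_sum: "sum (reset g) S = sum g S" if "S \<subseteq> V" for g S
    unfolding reset_def using that by (intro sum.cong) auto
  have reset_C: "reset g \<in> C" if "admissible g" for g
    using that assms(2) reset_sum unfolding C_def admissible_def by (auto simp: reset_def)
  have "compactin (product_topology (\<lambda>_. euclidean) UNIV) (PiE UNIV (\<lambda>_ :: 'a. {0..1 :: real}))"
    by (subst compactin_PiE) auto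
  then have "compact (PiE UNIV (\<lambda>_ :: 'a. {0..1 :: real}))"
    by (simp add: euclidean_product_topology)
  moreover have cont: "continuous_on UNIV (\<lambda>g :: 'a \<Rightarrow> real. sum g S)" for S
    by (intro continuous_on_sum continuous_on_product_coordinates)
  have "closed {g :: 'a \<Rightarrow> real. \<forall>S \<in> \<S>. 1 \<le> sum g S}"
    by (simp only: Collect_ball_eq) (intro closed_INT ballI closed_Collect_le cont continuous_on_const)
  moreover have "C = PiE UNIV (\<lambda>_. {0..1}) \<inter> {g. \<forall>S \<in> \<S>. 1 \<le> sum g S}"
    unfolding C_def by (auto simp: PiE_def Pi_def)
  ultimately have "compact C"
    by (simp add: compact_Int_closed)
  moreover have "C \<noteq> {}"
    using reset_C assms(3) by blast
  ultimately obtain g where g: "g \<in> C" "\<And>g'. g' \<in> C \<Longrightarrow> sum g V \<le> sum g' V"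
    using continuous_attains_inf [of C "\<lambda>g. sum g V"] cont continuous_on_subset by blast
  show thesis
  proof
    show "admissible g"
      using g(1) by (auto simp: C_def admissible_def)
    show "sum g V \<le> sum g' V" if "admissible g'" for g'
      using g(2) [OF reset_C [OF that]] reset_sum [of V g'] by simp
  qed
qed

lemma graph_dist_eq_0_iff:
  assumes "pair_wf_digraph G" "x \<in> pverts G"
  shows "graph_dist G x y = 0 \<longleftrightarrow> x = y"
proof
  interpret pair_wf_digraph G by fact
  show "graph_dist G x y = 0" if "x = y"
  proof -
    have "graph_dist G x y \<le> enat (length ([] :: ('a \<times> 'a) list))"
      unfolding graph_dist_def
      by (rule INF_lower) (use that assms(2) in \<open>simp add: apath_Nil_iff\<close>)
    then show ?thesis by (simp add: zero_enat_def [symmetric])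
  qed
  show "x = y" if "graph_dist G x y = 0"
  proof (rule ccontr)
    assume "x \<noteq> y"
    have "enat 1 \<le> graph_dist G x y"
      unfolding graph_dist_def
    proof (rule INF_greatest)
      fix p assume "p \<in> {p. apath x p y}"
      with \<open>x \<noteq> y\<close> have "p \<noteq> []" by (auto simp: apath_Nil_iff)
      then show "enat 1 \<le> enat (length p)" by (cases p) auto
    qed
    with that show False by (simp add: zero_enat_def)
  qed
qed

lemma graph_dist_adjacent:
  assumes "pair_wf_digraph G" "(x, y) \<in> parcs G" "x \<noteq> y"
  shows "graph_dist G x y = 1"
proof -
  interpret pair_wf_digraph G by fact
  have verts: "x \<in> pverts G" "y \<in> pverts G"
    using assms(2) in_arcsD1 in_arcsD2 by auto
  have "graph_dist G x y \<le> enat (length [(x, y)])"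
    unfolding graph_dist_def
    by (rule INF_lower) (use verts assms(2,3) in \<open>simp add: apath_simps\<close>)
  moreover have "graph_dist G x y \<noteq> 0"
    using graph_dist_eq_0_iff [OF assms(1) verts(1)] assms(3) by simp
  ultimately show ?thesis
    by (cases "graph_dist G x y") (auto simp: one_enat_def zero_enat_def)
qed

lemma endpoints_in_resolving_neighbourhood:
  assumes "pair_wf_digraph G" "x \<in> pverts G" "y \<in> pverts G" "x \<noteq> y"
  shows "{x, y} \<subseteq> resolving_neighbourhood G x y"
proof -
  have "graph_dist G x x = 0" "graph_dist G y y = 0" "graph_dist G x y \<noteq> 0" "graph_dist G y x \<noteq> 0"
    using assms(2-4) by (simp_all add: graph_dist_eq_0_iff [OF assms(1)])
  with assms(2,3) show ?thesis by (simp add: resolving_neighbourhood_def)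
qed

lemma resolving_neighbourhood_complete:
  assumes "pair_wf_digraph G" "parcs G = {(u, v). (u, v) \<in> pverts G \<times> pverts G \<and> u \<noteq> v}"
    and "x \<in> pverts G" "y \<in> pverts G" "x \<noteq> y"
  shows "resolving_neighbourhood G x y = {x, y}"
proof
  show "resolving_neighbourhood G x y \<subseteq> {x, y}"
  proof
    fix z assume z: "z \<in> resolving_neighbourhood G x y"
    show "z \<in> {x, y}"
    proof (rule ccontr)
      assume "z \<notin> {x, y}"
      with z have "graph_dist G x z = 1" "graph_dist G y z = 1"
        using assms by (auto simp: resolving_neighbourhood_def intro!: graph_dist_adjacent)
      with z show False by (simp add: resolving_neighbourhood_def)
    qed
  qed
qed (rule endpoints_in_resolving_neighbourhood [OF assms(1,3-5)])

text \<open>Double counting over ordered pairs: each vertex lies in \<open>2(n - 1)\<close> of the \<open>n(n - 1)\<close> pairs,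
  so total weight times \<open>2(n - 1)\<close> is at least \<open>n(n - 1)\<close>.\<close>

lemma weight_ge_half_card:
  fixes g :: "'a \<Rightarrow> real"
  assumes "2 \<le> card V" and pair: "\<And>x y. x \<in> V \<Longrightarrow> y \<in> V \<Longrightarrow> x \<noteq> y \<Longrightarrow> 1 \<le> g x + g y"
  shows "real (card V) / 2 \<le> sum g V"
proof -
  have fin: "finite V" using assms(1) by (intro card_ge_0_finite) simp
  define m where "m = real (card V) - 1"
  have m: "m > 0" using assms(1) by (simp add: m_def)
  have card_del: "real (card (V - {x})) = m" if "x \<in> V" for x
    using that assms(1) by (simp add: m_def card_Diff_singleton of_nat_diff)
  have "real (card V) * m = (\<Sum>x\<in>V. \<Sum>y\<in>V - {x}. 1)"
    using card_del by simp
  also have "\<dots> \<le> (\<Sum>x\<in>V. \<Sum>y\<in>V - {x}. g x + g y)"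
    by (intro sum_mono pair) auto
  also have "\<dots> = (\<Sum>x\<in>V. m * g x + (sum g V - g x))"
    using fin card_del by (intro sum.cong) (simp_all add: sum.distrib sum_diff1)
  also have "\<dots> = 2 * sum g V * m"
    unfolding sum.distrib sum_subtractf sum_distrib_left [symmetric]
    by (simp add: m_def algebra_simps)
  finally show ?thesis using m by simp
qed

lemma resolving_function_complete_weight:
  assumes "complete_digraph n (with_proj G)" "2 \<le> n" "resolving_function G g"
  shows "real n / 2 \<le> sum g (pverts G)"
proof -
  have G: "card (pverts G) = n"
    "parcs G = {(u, v). (u, v) \<in> pverts G \<times> pverts G \<and> u \<noteq> v}"
    using assms(1) by (simp_all add: complete_digraph_pair_def)
  have wf: "pair_wf_digraph G"
    by (rule pair_wf_digraph.intro) (auto simp: G(2))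
  have "1 \<le> g x + g y" if "x \<in> pverts G" "y \<in> pverts G" "x \<noteq> y" for x y
  proof -
    have "1 \<le> sum g (resolving_neighbourhood G x y)"
      using assms(3) that by (simp add: resolving_function_def)
    with that show ?thesis by (simp add: resolving_neighbourhood_complete [OF wf G(2)])
  qed
  then have "real (card (pverts G)) / 2 \<le> sum g (pverts G)"
    using G(1) assms(2) by (intro weight_ge_half_card) auto
  with G(1) show ?thesis by simp
qed

lemma simultaneous_resolving_function_half:
  assumes "\<And>G. G \<in> \<G> \<Longrightarrow> pair_fin_digraph G \<and> pverts G = V"
  shows "simultaneous_resolving_function V \<G> (\<lambda>_. 1 / 2)"
proof -
  have "1 \<le> (\<Sum>_\<in>resolving_neighbourhood G x y. 1 / 2 :: real)"
    if G: "G \<in> \<G>" and xy: "x \<in> pverts G" "y \<in> pverts G" "x \<noteq> y" for G x y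
  proof -
    interpret pair_fin_digraph G using assms G by blast
    have "finite (resolving_neighbourhood G x y)"
      using pair_finite_verts by (simp add: resolving_neighbourhood_def)
    moreover have "{x, y} \<subseteq> resolving_neighbourhood G x y"
      by (rule endpoints_in_resolving_neighbourhood [OF pair_wf_digraph_axioms xy])
    ultimately have "(\<Sum>_\<in>{x, y}. 1 / 2 :: real) \<le> (\<Sum>_\<in>resolving_neighbourhood G x y. 1 / 2)"
      by (intro sum_mono2) auto
    with xy show ?thesis by simp
  qed
  then show ?thesis
    by (simp add: simultaneous_resolving_function_def resolving_function_def)
qed

lemma simultaneous_resolving_function_truncated_sum:
  assumes "finite I"
    and res: "\<And>i. i \<in> I \<Longrightarrow> resolving_function (G i) (g i) \<and> pverts (G i) = V"
  shows "simultaneous_resolving_function V (G ` I) (\<lambda>v. min 1 (\<Sum>i\<in>I. g i v))"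
proof -
  let ?h = "\<lambda>v. min 1 (\<Sum>i\<in>I. g i v)"
  have bounds: "0 \<le> g i v \<and> g i v \<le> 1" if "i \<in> I" "v \<in> V" for i v
    using res that by (auto simp: resolving_function_def)
  have h: "0 \<le> ?h v" if "v \<in> V" for v
    using bounds that by (simp add: sum_nonneg)
  have dominates: "g i v \<le> ?h v" if "i \<in> I" "v \<in> V" for i v
    using bounds that \<open>finite I\<close> by (auto intro: member_le_sum)
  have "1 \<le> sum ?h (resolving_neighbourhood (G i) x y)"
    if "i \<in> I" "x \<in> V" "y \<in> V" "x \<noteq> y" for i x y
  proof -
    have "1 \<le> sum (g i) (resolving_neighbourhood (G i) x y)"
      using res that by (auto simp: resolving_function_def)
    also have "\<dots> \<le> sum ?h (resolving_neighbourhood (G i) x y)"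
      using res that(1) by (intro sum_mono dominates) (auto simp: resolving_neighbourhood_def)
    finally show ?thesis .
  qed
  with h res show ?thesis
    by (auto simp: simultaneous_resolving_function_def resolving_function_def)
qed

lemma Sd_f_attained:
  assumes "\<And>G. G \<in> \<G> \<Longrightarrow> pair_fin_digraph G \<and> pverts G = V"
  obtains g where "simultaneous_resolving_function V \<G> g" "sum g V = Sd_f V \<G>"
    and "\<And>h. simultaneous_resolving_function V \<G> h \<Longrightarrow> Sd_f V \<G> \<le> sum h V"
proof -
  define \<S> where "\<S> = {resolving_neighbourhood G x y | G x y.
    G \<in> \<G> \<and> x \<in> V \<and> y \<in> V \<and> x \<noteq> y}"
  have srf: "simultaneous_resolving_function V \<G> g \<longleftrightarrow>
    (\<forall>v \<in> V. 0 \<le> g v \<and> g v \<le> 1) \<and> (\<forall>S \<in> \<S>. 1 \<le> sum g S)" for g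
    using assms unfolding simultaneous_resolving_function_def resolving_function_def \<S>_def
    by blast
  have "S \<subseteq> V" if "S \<in> \<S>" for S
    using that assms by (auto simp: \<S>_def resolving_neighbourhood_def)
  then obtain g where g: "simultaneous_resolving_function V \<G> g"
    "\<And>h. simultaneous_resolving_function V \<G> h \<Longrightarrow> sum g V \<le> sum h V"
    by (rule minimum_weight_attained [of \<S> V, folded srf])
      (use simultaneous_resolving_function_half [OF assms] in auto)
  have "Sd_f V \<G> = sum g V"
    unfolding Sd_f_def using g by (intro Least_equality) auto
  with g show thesis by (intro that) auto
qed

lemma dim_f_eq_Sd_f: "dim_f G = Sd_f (pverts G) {G}"
  by (simp add: dim_f_def Sd_f_def simultaneous_resolving_function_def resolving_function_def)

lemma dim_f_attained:
  assumes "pair_fin_digraph G"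
  obtains g where "resolving_function G g" "sum g (pverts G) = dim_f G"
    and "\<And>h. resolving_function G h \<Longrightarrow> dim_f G \<le> sum h (pverts G)"
proof -
  have srf: "simultaneous_resolving_function (pverts G) {G} g \<longleftrightarrow> resolving_function G g" for g
    by (auto simp: simultaneous_resolving_function_def resolving_function_def)
  show thesis
    using Sd_f_attained [of "{G}" "pverts G", unfolded srf] assms that
    by (auto simp: dim_f_eq_Sd_f)
qed

theorem mainTheorem1:
  fixes V :: "'a set" and k :: nat and G :: "nat \<Rightarrow> 'a pair_pre_digraph"
  assumes "2 \<le> k"
    and "\<And>i. i \<in> {1..k} \<Longrightarrow> pair_graph (G i)"
    and "\<And>i. i \<in> {1..k} \<Longrightarrow> Digraph_Component.connected (with_proj (G i))"
    and "\<And>i. i \<in> {1..k} \<Longrightarrow> pverts (G i) = V"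
    and "3 \<le> card V"
  shows "Max ((\<lambda>i. dim_f (G i)) ` {1..k}) \<le> Sd_f V (G ` {1..k}) \<and>
    Sd_f V (G ` {1..k}) \<le> min (\<Sum>i = 1..k. dim_f (G i)) (real (card V) / 2) \<and>
    ((\<exists>i \<in> {1..k}. complete_digraph (card V) (with_proj (G i))) \<longrightarrow>
      Sd_f V (G ` {1..k}) = min (\<Sum>i = 1..k. dim_f (G i)) (real (card V) / 2))"
proof -
  let ?I = "{1..k}" and ?\<G> = "G ` {1..k}"
  have V: "pverts (G i) = V" if "i \<in> ?I" for i using assms(4) that .
  have fin: "pair_fin_digraph (G i)" if "i \<in> ?I" for i
    using assms(2) [OF that] by (simp add: pair_graph_def pair_digraph_def)
  obtain g where g: "simultaneous_resolving_function V ?\<G> g" "sum g V = Sd_f V ?\<G>"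
    and min: "\<And>h. simultaneous_resolving_function V ?\<G> h \<Longrightarrow> Sd_f V ?\<G> \<le> sum h V"
    by (rule Sd_f_attained [of ?\<G> V]) (use fin V in blast)+
  have "\<forall>i \<in> ?I. \<exists>g. resolving_function (G i) g \<and> sum g V = dim_f (G i)"
    using dim_f_attained fin V by metis
  then obtain gi where gi: "\<And>i. i \<in> ?I \<Longrightarrow> resolving_function (G i) (gi i)"
    and gi_sum: "\<And>i. i \<in> ?I \<Longrightarrow> sum (gi i) V = dim_f (G i)"
    by metis
  have g_res: "resolving_function (G i) g" if "i \<in> ?I" for i
    using g(1) that by (simp add: simultaneous_resolving_function_def)
  have lower: "dim_f (G i) \<le> Sd_f V ?\<G>" if "i \<in> ?I" for i
    using dim_f_attained [OF fin [OF that]] g_res [OF that] g(2) V [OF that] by metis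

  have "Sd_f V ?\<G> \<le> (\<Sum>v\<in>V. min 1 (\<Sum>i\<in>?I. gi i v))"
    using gi V by (intro min simultaneous_resolving_function_truncated_sum) auto
  also have "\<dots> \<le> (\<Sum>v\<in>V. \<Sum>i\<in>?I. gi i v)"
    by (intro sum_mono) simp
  also have "\<dots> = (\<Sum>i\<in>?I. dim_f (G i))"
    using gi_sum by (subst sum.swap) simp
  finally have upper_sum: "Sd_f V ?\<G> \<le> (\<Sum>i\<in>?I. dim_f (G i))" .

  have "simultaneous_resolving_function V ?\<G> (\<lambda>_. 1 / 2)"
    using fin V by (intro simultaneous_resolving_function_half) auto
  from min [OF this] have upper_half: "Sd_f V ?\<G> \<le> real (card V) / 2" by simp

  have complete: "real (card V) / 2 \<le> Sd_f V ?\<G>"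
    if "i \<in> ?I" "complete_digraph (card V) (with_proj (G i))" for i
    using resolving_function_complete_weight [OF that(2) _ g_res [OF that(1)]]
      g(2) V [OF that(1)] assms(5) by simp

  have "Max ((\<lambda>i. dim_f (G i)) ` ?I) \<le> Sd_f V ?\<G>"
    using lower assms(1) by (subst Max_le_iff) auto
  then show ?thesis
    using upper_sum upper_half complete by (force simp: min_def)
qed

end
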